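(* For all integers $m,q,k\ge 1$: (a) the image of $\mathrm{MCDB}(m,q,k)$ under $\mathrm{EBWT}$ is $(\mathcal{P}_{m,q})^{q^{k-1}}$; (b) $|\mathrm{MCDB}(m,q,k)|=W(m,q,k)=\dfrac{(mq)!^{q^{k-1}}}{m!^{q^k}}$.
   Context: Let $\Omega=\{0,1,\ldots,q-1\}$ with its usual order. For a linear sequence $s$, $s^i$ is the concatenation of $i$ copies of $s$, and $\rho(a_1\ldots a_n)=a_na_1\ldots a_{n-1}$. A sequence $s$ is primitive if it is nonempty and not of the form $t^d$ with $d>1$; equivalently the cycle $(s)$ (the set of rotations of $s$) is aperiodic. A multicyclic sequence is a finite multiset of aperiodic cycles, written $(s_1)(s_2)\cdots(s_r)$; its length is $\sum|s_i|$, and $\mathcal{M}_n$ is the set of multicyclic sequences of length $n$. For a primitive $s$ and nonempty $w$, the number of occurrences of $w$ in $(s)$ is the number of $j\in\{0,\ldots,|s|-1\}$ such that $w$ is a prefix of some power of $\rho^j(s)$; the number of occurrences in a multicyclic sequence is the sum over its cycles counted with multiplicity. $\mathrm{MCDB}(m,q,k)$ is the set of multicyclic sequences over $\Omega$ in which every $k$-mer in $\Omega^k$ occurs exactly $m$ times. $\mathcal{P}_{m,q}$ is the set of words of length $mq$ over $\Omega$ in which each symbol occurs exactly $m$ times, and $(\mathcal{P}_{m,q})^{q^{k-1}}$ is the set of concatenations $w_1w_2\cdots w_{q^{k-1}}$ with each $w_i\in\mathcal{P}_{m,q}$. The Extended Burrows–Wheeler Transform: for $\sigma=(s_1)\cdots(s_r)\in\mathcal{M}_n$,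 let $c=\mathrm{lcm}(|s_1|,\ldots,|s_r|)$; for each cycle $(s_i)$ (repeated according to its multiplicity) and each $j=0,\ldots,|s_i|-1$ form the row $(\rho^j(s_i))^{c/|s_i|}$ of length $c$; sort these $n$ rows lexicographically into an $n\times c$ table; $\mathrm{EBWT}(\sigma)\in\Omega^n$ is the last column read from top to bottom. Set $W(m,q,k)=((mq)!/m!^q)^{q^{k-1}}$. *)

theory Defs
  imports Complex_Main "HOL-Library.Multiset" "HOL-Library.Sublist" "HOL-Library.List_Lexorder"
begin

definition wpow :: "'a list \<Rightarrow> nat \<Rightarrow> 'a list" where
  "wpow s i = concat (replicate i s)"

definition rho :: "'a list \<Rightarrow> 'a list" where
  "rho s = (if s = [] then [] else last s # butlast s)"

definition primitive :: "'a list \<Rightarrow> bool" where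
  "primitive s \<longleftrightarrow> s \<noteq> [] \<and> \<not> (\<exists>t d. d > 1 \<and> s = wpow t d)"

definition cycle :: "'a list \<Rightarrow> 'a list set" where
  "cycle s = {(rho ^^ j) s | j. True}"

text \<open>Words over \<open>\<Omega> = {0,\<dots>,q-1}\<close> are elements of \<open>lists {..<q}\<close>.\<close>

definition multicyclic :: "nat \<Rightarrow> nat list set multiset set" where
  "multicyclic q = {\<sigma>. \<forall>C \<in># \<sigma>. \<exists>s \<in> lists {..<q}. primitive s \<and> C = cycle s}"

text \<open>
  Occurrence counts and table rows are defined on linear words; a cycle \<open>C\<close> is unfolded through an
  arbitrary representative \<open>cyc_rep C\<close>. The lemmas \<open>length_cycle\<close>, \<open>occ_cycle\<close> and
  \<open>ebwt_rows_cycle\<close> below show that the choice of representative is irrelevant.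
\<close>

definition cyc_rep :: "'a list set \<Rightarrow> 'a list" where
  "cyc_rep C = (SOME s. s \<in> C)"

definition occ :: "'a list \<Rightarrow> 'a list \<Rightarrow> nat" where
  "occ w s = card {j. j < length s \<and> (\<exists>p. prefix w (wpow ((rho ^^ j) s) p))}"

definition mc_occ :: "'a list \<Rightarrow> 'a list set multiset \<Rightarrow> nat" where
  "mc_occ w \<sigma> = (\<Sum>C\<in>#\<sigma>. occ w (cyc_rep C))"

definition MCDB :: "nat \<Rightarrow> nat \<Rightarrow> nat \<Rightarrow> nat list set multiset set" where
  "MCDB m q k =
     {\<sigma> \<in> multicyclic q. \<forall>w \<in> lists {..<q}. length w = k \<longrightarrow> mc_occ w \<sigma> = m}"

definition ebwt_rows :: "nat \<Rightarrow> 'a list \<Rightarrow> 'a list multiset" where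
  "ebwt_rows c s = {# wpow ((rho ^^ j) s) (c div length s). j \<in># mset_set {..<length s} #}"

definition ebwt_lcm :: "'a list set multiset \<Rightarrow> nat" where
  "ebwt_lcm \<sigma> = Lcm {length (cyc_rep C) | C. C \<in># \<sigma>}"

text \<open>The order on words used by \<open>sorted_list_of_multiset\<close> is the lexicographic one.\<close>

definition ebwt_table :: "'a::linorder list set multiset \<Rightarrow> 'a list list" where
  "ebwt_table \<sigma> = sorted_list_of_multiset (\<Sum>C\<in>#\<sigma>. ebwt_rows (ebwt_lcm \<sigma>) (cyc_rep C))"

definition EBWT :: "'a::linorder list set multiset \<Rightarrow> 'a list" where
  "EBWT \<sigma> = map last (ebwt_table \<sigma>)"

definition Pwords :: "nat \<Rightarrow> nat \<Rightarrow> nat list set" where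
  "Pwords m q = {w \<in> lists {..<q}. length w = m * q \<and> (\<forall>a<q. count_list w a = m)}"

definition lang_pow :: "'a list set \<Rightarrow> nat \<Rightarrow> 'a list set" where
  "lang_pow A n = {concat ws | ws. length ws = n \<and> set ws \<subseteq> A}"

definition W :: "nat \<Rightarrow> nat \<Rightarrow> nat \<Rightarrow> real" where
  "W m q k = (fact (m * q) / fact m ^ q) ^ (q ^ (k - 1))"

lemma length_rho [simp]: "length (rho s) = length s"
  by (simp add: rho_def)

lemma length_rho_pow [simp]: "length ((rho ^^ j) s) = length s"
  by (induction j) auto

lemma rho_rotate1 [simp]: "rho (rotate1 s) = s"
  by (cases s) (auto simp: rho_def)

lemma rho_pow_rotate: "(rho ^^ n) (rotate n s) = s"
proof (induction n)
  case (Suc n)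
  have "(rho ^^ Suc n) (rotate (Suc n) s) = (rho ^^ n) (rho (rotate1 (rotate n s)))"
    by (simp add: funpow_swap1)
  then show ?case using Suc by simp
qed simp

lemma rho_pow_length: "(rho ^^ length s) s = s"
  using rho_pow_rotate[of "length s" s] by simp

lemma rho_pow_mod: "(rho ^^ (j mod length s)) s = (rho ^^ j) s"
  by (rule funpow_mod_eq) (rule rho_pow_length)

lemma length_cycle: "t \<in> cycle s \<Longrightarrow> length t = length s"
  by (auto simp: cycle_def)

lemma rotations_cycle:
  assumes "t \<in> cycle s"
  shows "{# (rho ^^ j) t. j \<in># mset_set {..<length t} #} =
         {# (rho ^^ j) s. j \<in># mset_set {..<length s} #}"
proof (cases "s = []")
  case True
  then show ?thesis using length_cycle[OF assms] by simp
next
  case False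
  define n where "n = length s"
  have n: "n > 0" using False by (simp add: n_def)
  obtain i where t: "t = (rho ^^ i) s" using assms by (auto simp: cycle_def)
  define f where "f = (\<lambda>j. (j + i) mod n)"
  have inj: "inj_on f {..<n}"
  proof (rule linorder_inj_onI)
    fix x y assume xy: "x < y" "x \<in> {..<n}" "y \<in> {..<n}"
    have "\<not> n dvd y - x" using xy by (auto dest: dvd_imp_le)
    then show "f x \<noteq> f y"
      using mod_eq_dvd_iff_nat[of "x + i" "y + i" n] xy by (auto simp: f_def)
  qed auto
  have "f ` {..<n} = {..<n}"
    by (rule endo_inj_surj[OF _ _ inj]) (auto simp: f_def n)
  then have im: "image_mset f (mset_set {..<n}) = mset_set {..<n}"
    using image_mset_mset_set[OF inj] by simp
  have eq: "(rho ^^ j) t = (rho ^^ f j) s" for j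
    using rho_pow_mod[of "j + i" s] by (simp add: t f_def n_def funpow_add)
  have "{# (rho ^^ j) t. j \<in># mset_set {..<n} #} =
        image_mset (\<lambda>j. (rho ^^ j) s) (image_mset f (mset_set {..<n}))"
    by (simp add: eq multiset.map_comp comp_def)
  then show ?thesis
    using length_cycle[OF assms] im by (simp add: n_def)
qed

lemma ebwt_rows_cycle: "t \<in> cycle s \<Longrightarrow> ebwt_rows c t = ebwt_rows c s"
  using arg_cong[OF rotations_cycle[of t s], of "image_mset (\<lambda>u. wpow u (c div length s))"]
  by (simp add: ebwt_rows_def length_cycle multiset.map_comp comp_def)

lemma occ_size:
  "occ w s = size {# u \<in># {# (rho ^^ j) s. j \<in># mset_set {..<length s} #}. \<exists>p. prefix w (wpow u p) #}"
  by (simp add: occ_def filter_mset_image_mset)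

lemma occ_cycle: "t \<in> cycle s \<Longrightarrow> occ w t = occ w s"
  by (simp only: occ_size rotations_cycle)

end

theory Submission
  imports "HOL-Library.Product_Lexorder" "HOL-Combinatorics.Cycles"
    "HOL-Combinatorics.Multiset_Permutations" Defs
begin

text \<open>
  A multicyclic sequence amounts to a multiset of equally long rows that is invariant under rotation.
  Such a multiset is determined by the last column \<open>w\<close> of its sorted table, since \<open>w\<close> determines the
  multiset of length-\<open>j\<close> prefixes for every \<open>j\<close> in turn. Conversely the stable sorting permutation of any
  word \<open>w\<close> produces an invariant multiset with last column \<open>w\<close>, so \<open>EBWT\<close> is a bijection onto all words.
  If every \<open>j\<close>-mer is a prefix of exactly \<open>M q\<close> rows, these rows are consecutive, and the letters of \<open>w\<close>
  in that block are the letters preceding the \<open>j\<close>-mer. Hence every \<open>(j+1)\<close>-mer occurs \<open>M\<close> times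
  iff every letter occurs \<open>M\<close> times in every block of \<open>w\<close>.
\<close>

subsection \<open>Words and primitive roots\<close>

lemma wpow_0 [simp]: "wpow s 0 = []"
  and wpow_Suc [simp]: "wpow s (Suc d) = s @ wpow s d"
  by (simp_all add: wpow_def)

lemma wpow_Nil [simp]: "wpow [] d = []"
  by (induction d) auto

lemma wpow_add: "wpow s (a + b) = wpow s a @ wpow s b"
  by (induction a) auto

lemma length_wpow [simp]: "length (wpow s d) = d * length s"
  by (induction d) auto

lemma wpow_wpow: "wpow (wpow s a) b = wpow s (a * b)"
  by (induction b) (auto simp: wpow_add)

lemma wpow_Suc_right: "wpow s (Suc d) = wpow s d @ s"
  using wpow_add[of s d 1] by simp

lemma wpow_in_lists: "s \<in> lists A \<Longrightarrow> wpow s d \<in> lists A"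
  by (induction d) auto

lemma last_wpow: "d > 0 \<Longrightarrow> last (wpow s d) = last s"
  by (cases d; cases "s = []") (simp_all add: wpow_Suc_right del: wpow_Suc)

lemma rotate1_rho [simp]: "rotate1 (rho s) = s"
  by (cases s rule: rev_cases) (auto simp: rho_def)

lemma rotate1_wpow: "rotate1 (wpow s d) = wpow (rotate1 s) d"
proof (cases s)
  case (Cons x xs)
  have "wpow (x # xs) d @ [x] = x # wpow (xs @ [x]) d" for d
    by (induction d) auto
  then show ?thesis
    using Cons by (cases d) auto
qed simp

lemma rho_wpow: "rho (wpow s d) = wpow (rho s) d"
  by (metis rho_rotate1 rotate1_rho rotate1_wpow)

lemma rho_pow_wpow: "(rho ^^ j) (wpow s d) = wpow ((rho ^^ j) s) d"
  by (induction j) (auto simp: rho_wpow)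

lemma rotate_rho_pow: "rotate j ((rho ^^ j) s) = s"
proof (induction j arbitrary: s)
  case (Suc j)
  have "rotate (Suc j) ((rho ^^ Suc j) s) = rotate j (rotate1 (rho ((rho ^^ j) s)))"
    by (simp add: rotate1_rotate_swap)
  then show ?case using Suc by simp
qed simp

lemma rho_pow_in_lists: "s \<in> lists A \<Longrightarrow> (rho ^^ j) s \<in> lists A"
  by (metis in_listsD in_listsI rotate_rho_pow set_rotate)

lemma take_Suc_rho: "j < length x \<Longrightarrow> take (Suc j) (rho x) = last x # take j x"
  by (auto simp: rho_def take_butlast)

text \<open>Any two powers of \<open>u\<close> are prefixes of one common power, so the unbounded
  search for \<open>p\<close> can be replaced by a test on one sufficiently long power.\<close>

lemma prefix_wpow_iff:
  assumes "length w \<le> d * length u"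
  shows "(\<exists>p. prefix w (wpow u p)) \<longleftrightarrow> take (length w) (wpow u d) = w"
proof
  assume "\<exists>p. prefix w (wpow u p)"
  then obtain p where "prefix w (wpow u p)" ..
  then have "prefix w (wpow u d @ wpow u p)"
    by (metis add.commute prefix_prefix wpow_add)
  then show "take (length w) (wpow u d) = w"
    using assms by (metis append_eq_conv_conj length_wpow prefix_def prefix_length_prefix prefix_prefix)
next
  assume "take (length w) (wpow u d) = w"
  then show "\<exists>p. prefix w (wpow u p)" by (metis take_is_prefix)
qed

lemma primitive_nonempty: "primitive s \<Longrightarrow> s \<noteq> []"
  by (simp add: primitive_def)

lemma primitive_wpow_exponent:
  assumes "primitive (wpow z d)" shows "d = 1"
proof -
  have "d \<noteq> 0" using assms by (metis primitive_nonempty wpow_0)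
  moreover have "\<not> d > 1" using assms unfolding primitive_def by blast
  ultimately show ?thesis by simp
qed

lemma exists_primitive_root:
  "x \<noteq> [] \<Longrightarrow> \<exists>s d. primitive s \<and> x = wpow s d"
proof (induction "length x" arbitrary: x rule: less_induct)
  case less
  show ?case
  proof (cases "primitive x")
    case True
    then show ?thesis by (intro exI[of _ x] exI[of _ 1]) simp
  next
    case False
    then obtain t d where td: "d > 1" "x = wpow t d" using less.prems by (auto simp: primitive_def)
    then have "t \<noteq> []" using less.prems by auto
    then have "length t < length x" using td by simp
    then obtain s e where "primitive s" "t = wpow s e" using less.hyps \<open>t \<noteq> []\<close> by blast
    then show ?thesis using td by (auto simp: wpow_wpow)
  qed
qed

section \<open>Commuting words and uniqueness of primitive roots\<close>

lemma commuting_words: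
  assumes "x @ y = y @ x"
  obtains z a b where "x = wpow z a" "y = wpow z b"
  using comm_append_are_replicate[OF assms] by (auto simp: wpow_def)

lemma commuting_primitive_eq:
  assumes "primitive s" "primitive t" "s @ t = t @ s"
  shows "s = t"
  by (metis assms commuting_words primitive_wpow_exponent)

text \<open>A word commuting with \<open>x\<close> commutes with all powers of \<open>x\<close>,
  hence is a prefix of a long one; its length then determines it.\<close>

lemma commute_same_length:
  assumes "u @ x = x @ u" "v @ x = x @ v" "length u = length v" "x \<noteq> []"
  shows "u = v"
proof -
  have pow: "y @ wpow x i = wpow x i @ y" if "y @ x = x @ y" for y i
  proof (induction i)
    case (Suc i)
    have "y @ wpow x (Suc i) = x @ y @ wpow x i" using that by simp
    then show ?case using Suc by simp
  qed simp
  have "length u * 1 \<le> length u * length x"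
    using assms(4) by (intro mult_le_mono) (auto simp: Suc_le_eq)
  then have le: "length u \<le> length (wpow x (length u))" by simp
  have "u = take (length u) (u @ wpow x (length u))" by simp
  also have "\<dots> = take (length u) (wpow x (length u))"
    using le by (subst pow[OF assms(1)]) simp
  also have "\<dots> = take (length v) (v @ wpow x (length u))"
    using le assms(3) by (subst pow[OF assms(2)]) simp
  finally show ?thesis by simp
qed

text \<open>Both roots commute with the common power \<open>x\<close>, hence so do
  \<open>s @ t\<close> and \<open>t @ s\<close>. These have equal length and therefore coincide, and
  commuting primitive words are equal.\<close>

lemma primitive_root_unique:
  assumes "primitive s" "primitive t" "wpow s a = wpow t b" "wpow s a \<noteq> []"
  shows "s = t"
proof -
  define x where "x = wpow s a"
  have s: "s @ x = x @ s" using wpow_Suc_right[of s a] by (simp add: x_def)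
  have t: "t @ x = x @ t" using wpow_Suc_right[of t b] assms(3) by (simp add: x_def)
  have "s @ t = t @ s"
  proof (rule commute_same_length[of _ x])
    show "(s @ t) @ x = x @ s @ t" using s t by (metis append.assoc)
    show "(t @ s) @ x = x @ t @ s" using s t by (metis append.assoc)
  qed (use assms x_def in auto)
  then show ?thesis using commuting_primitive_eq assms by blast
qed

lemma primitive_rho_pow:
  assumes "primitive s" shows "primitive ((rho ^^ j) s)"
proof -
  have "\<not> (d > 1 \<and> (rho ^^ j) s = wpow t d)" for t d
  proof
    assume a: "d > 1 \<and> (rho ^^ j) s = wpow t d"
    have rp: "rotate i (wpow t d) = wpow (rotate i t) d" for i
      by (induction i) (auto simp: rotate1_wpow)
    have "s = wpow (rotate j t) d" using a rp by (metis rotate_rho_pow)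
    then show False using a assms unfolding primitive_def by blast
  qed
  moreover have "(rho ^^ j) s \<noteq> []"
    using assms by (metis length_0_conv length_rho_pow primitive_nonempty)
  ultimately show ?thesis by (auto simp: primitive_def)
qed

text \<open>A rotation fixing \<open>s\<close> makes the two parts at the cut commute, so both are
  powers of one word \<open>z\<close>. Primitivity leaves total exponent 1, which forces one part to
  be empty.\<close>

lemma primitive_rotate_neq:
  assumes "primitive s" "0 < j" "j < length s"
  shows "rotate j s \<noteq> s"
proof
  assume "rotate j s = s"
  then have "drop j s @ take j s = take j s @ drop j s"
    using assms by (simp add: rotate_drop_take)
  then obtain z a b where z: "drop j s = wpow z a" "take j s = wpow z b"
    by (rule commuting_words)
  then have "s = wpow z (b + a)" by (metis append_take_drop_id wpow_add)
  then have "b + a = 1" using assms primitive_wpow_exponent by blast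
  then have "drop j s = [] \<or> take j s = []" using z by (cases b) auto
  then show False using assms by auto
qed

lemma primitive_rotations_distinct:
  assumes "primitive s"
  shows "inj_on (\<lambda>j. (rho ^^ j) s) {..<length s}"
proof (rule linorder_inj_onI)
  fix i j assume ij: "i < j" "i \<in> {..<length s}" "j \<in> {..<length s}"
  show "(rho ^^ i) s \<noteq> (rho ^^ j) s"
  proof
    assume eq: "(rho ^^ i) s = (rho ^^ j) s"
    have "rotate (j - i) s = rotate (j - i) (rotate i ((rho ^^ j) s))"
      by (simp add: eq[symmetric] rotate_rho_pow)
    also have "\<dots> = s" using ij by (simp add: rotate_rotate rotate_rho_pow)
    finally have "rotate (j - i) s = s" .
    moreover have "0 < j - i" "j - i < length s" using ij by auto
    ultimately show False using primitive_rotate_neq[OF assms] by blast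
  qed
qed auto

subsection \<open>Rotation-invariant multisets of rows\<close>

text \<open>The analogue of \<open>multicyclic\<close> for an arbitrary alphabet, so that
  bijectivity can be shown over any linear order.\<close>

definition mcyc :: "'a set \<Rightarrow> 'a list set multiset set" where
  "mcyc A = {\<sigma>. \<forall>C \<in># \<sigma>. \<exists>s \<in> lists A. primitive s \<and> C = cycle s}"

text \<open>The table rows before sorting. The row length \<open>N\<close> is left free so that
  sequences with different \<open>ebwt_lcm\<close> can be compared at one common length.\<close>

definition all_rows :: "nat \<Rightarrow> 'a list set multiset \<Rightarrow> 'a list multiset" where
  "all_rows N \<sigma> = (\<Sum>C\<in>#\<sigma>. ebwt_rows N (cyc_rep C))"

lemma rho_pow_in_cycle: "(rho ^^ j) s \<in> cycle s"
  by (auto simp: cycle_def)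

lemma self_in_cycle: "s \<in> cycle s"
  using rho_pow_in_cycle[of 0] by simp

lemma cyc_rep_in_cycle: "cyc_rep (cycle s) \<in> cycle s"
  unfolding cyc_rep_def by (rule someI, rule self_in_cycle)

lemma cycle_eq_image:
  assumes "s \<noteq> []" shows "cycle s = (\<lambda>j. (rho ^^ j) s) ` {..<length s}"
proof
  show "cycle s \<subseteq> (\<lambda>j. (rho ^^ j) s) ` {..<length s}"
  proof
    fix t assume "t \<in> cycle s"
    then obtain j where "t = (rho ^^ j) s" by (auto simp: cycle_def)
    then have "t = (rho ^^ (j mod length s)) s" by (simp only: rho_pow_mod)
    moreover have "j mod length s \<in> {..<length s}" using assms by simp
    ultimately show "t \<in> (\<lambda>j. (rho ^^ j) s) ` {..<length s}" by (rule image_eqI)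
  qed
qed (auto simp: cycle_def)

lemma finite_cycle: "s \<noteq> [] \<Longrightarrow> finite (cycle s)"
  by (simp add: cycle_eq_image)

lemma cycle_of_mem:
  assumes "t \<in> cycle s" shows "cycle t = cycle s"
proof (cases "s = []")
  case True
  then have "t = []" using length_cycle[OF assms] by simp
  then show ?thesis using True by simp
next
  case False
  obtain i where t: "t = (rho ^^ i) s" using assms by (auto simp: cycle_def)
  have sub: "cycle ((rho ^^ i) x) \<subseteq> cycle x" for i and x :: "'a list"
    by (auto simp: cycle_def) (metis comp_apply funpow_add)
  \<comment> \<open>Rotating \<open>t\<close> by another \<open>length s * i - i\<close> places
    completes \<open>i\<close> full turns of \<open>s\<close>, which shows the reverse
    inclusion.\<close>
  have "i \<le> length s * i" using False by (cases s) auto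
  then have "(rho ^^ (length s * i - i)) t = (rho ^^ (length s * i)) s"
    by (metis t comp_apply funpow_add le_add_diff_inverse2)
  also have "\<dots> = s" using rho_pow_mod[of "length s * i" s] by simp
  finally have "cycle s \<subseteq> cycle t" using sub by metis
  then show ?thesis using sub t by blast
qed

lemma mcyc_cyc_rep:
  assumes "\<sigma> \<in> mcyc A" "C \<in># \<sigma>"
  shows "primitive (cyc_rep C)" "cyc_rep C \<in> lists A" "cycle (cyc_rep C) = C"
proof -
  obtain s where s: "s \<in> lists A" "primitive s" "C = cycle s" using assms unfolding mcyc_def by blast
  then have "cyc_rep C \<in> cycle s" using cyc_rep_in_cycle by auto
  then obtain j where "cyc_rep C = (rho ^^ j) s" by (auto simp: cycle_def)
  then show "primitive (cyc_rep C)" "cyc_rep C \<in> lists A"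
    using s primitive_rho_pow rho_pow_in_lists by metis+
  show "cycle (cyc_rep C) = C" using cycle_of_mem[OF \<open>cyc_rep C \<in> cycle s\<close>] s by simp
qed

text \<open>Zero is excluded: it is divisible by every length but would collapse all rows to the
  empty word.\<close>

definition common_multiple :: "'a list set multiset \<Rightarrow> nat \<Rightarrow> bool" where
  "common_multiple \<sigma> N \<longleftrightarrow> N > 0 \<and> (\<forall>C\<in>#\<sigma>. length (cyc_rep C) dvd N)"

lemma common_multiple_mult:
  "common_multiple \<sigma> N \<Longrightarrow> d > 0 \<Longrightarrow> common_multiple \<sigma> (N * d)"
  by (auto simp: common_multiple_def)

lemma ebwt_lcm_dvd_iff: "ebwt_lcm \<sigma> dvd N \<longleftrightarrow> (\<forall>C\<in>#\<sigma>. length (cyc_rep C) dvd N)"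
  by (auto simp: ebwt_lcm_def Lcm_dvd_iff)

lemma common_multiple_ebwt_lcm:
  assumes "\<sigma> \<in> mcyc A" shows "common_multiple \<sigma> (ebwt_lcm \<sigma>)"
proof -
  have "finite {length (cyc_rep C) | C. C \<in># \<sigma>}" by simp
  moreover have "0 \<notin> {length (cyc_rep C) | C. C \<in># \<sigma>}"
    using mcyc_cyc_rep(1)[OF assms] primitive_nonempty by fastforce
  ultimately have "ebwt_lcm \<sigma> \<noteq> 0"
    unfolding ebwt_lcm_def by (simp add: Lcm_0_iff)
  moreover have "\<forall>C\<in>#\<sigma>. length (cyc_rep C) dvd ebwt_lcm \<sigma>"
    using ebwt_lcm_dvd_iff[of \<sigma> "ebwt_lcm \<sigma>"] by simp
  ultimately show ?thesis by (simp add: common_multiple_def)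
qed

lemma all_rows_add [simp]:
  "all_rows N (add_mset C \<sigma>) = ebwt_rows N (cyc_rep C) + all_rows N \<sigma>"
  by (simp add: all_rows_def)

lemma all_rows_empty [simp]: "all_rows N {#} = {#}"
  by (simp add: all_rows_def)

lemma mcyc_add [simp]:
  "add_mset C \<sigma> \<in> mcyc A \<longleftrightarrow> (\<exists>s \<in> lists A. primitive s \<and> C = cycle s) \<and> \<sigma> \<in> mcyc A"
  by (auto simp: mcyc_def)

lemma mcyc_empty [simp]: "{#} \<in> mcyc A"
  by (simp add: mcyc_def)

lemma common_multiple_add [simp]:
  "common_multiple (add_mset C \<sigma>) N \<longleftrightarrow> length (cyc_rep C) dvd N \<and> common_multiple \<sigma> N"
  by (auto simp: common_multiple_def)

lemma ebwt_rows_mult: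
  assumes "length s dvd c"
  shows "ebwt_rows (c * d) s = image_mset (\<lambda>u. wpow u d) (ebwt_rows c s)"
  using assms
  by (auto simp: ebwt_rows_def multiset.map_comp comp_def wpow_wpow div_mult_swap mult.commute)

lemma all_rows_mult:
  "common_multiple \<sigma> c \<Longrightarrow> all_rows (c * d) \<sigma> = image_mset (\<lambda>u. wpow u d) (all_rows c \<sigma>)"
  by (induction \<sigma>) (auto simp: ebwt_rows_mult)

lemma length_ebwt_rows: "length s dvd N \<Longrightarrow> x \<in># ebwt_rows N s \<Longrightarrow> length x = N"
  by (auto simp: ebwt_rows_def)

lemma length_all_rows: "common_multiple \<sigma> N \<Longrightarrow> x \<in># all_rows N \<sigma> \<Longrightarrow> length x = N"
  by (induction \<sigma>) (auto simp: length_ebwt_rows)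

lemma all_rows_in_lists:
  "\<sigma> \<in> mcyc A \<Longrightarrow> x \<in># all_rows N \<sigma> \<Longrightarrow> x \<in> lists A"
proof (induction \<sigma>)
  case (add C \<sigma>)
  have "cyc_rep C \<in> lists A" using mcyc_cyc_rep[OF add.prems(1), of C] by simp
  then have "y \<in> lists A" if y: "y \<in># ebwt_rows N (cyc_rep C)" for y
  proof -
    obtain j where "y = wpow ((rho ^^ j) (cyc_rep C)) (N div length (cyc_rep C))"
      using y by (auto simp: ebwt_rows_def)
    then show ?thesis using \<open>cyc_rep C \<in> lists A\<close> by (metis wpow_in_lists rho_pow_in_lists)
  qed
  moreover have "x \<in># ebwt_rows N (cyc_rep C) \<or> x \<in># all_rows N \<sigma>" using add.prems(2) by simp
  moreover have "\<sigma> \<in> mcyc A" using add.prems(1) by simp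
  ultimately show ?case using add.IH by blast
qed simp

lemma ebwt_rows_rho: "image_mset rho (ebwt_rows N s) = ebwt_rows N s"
proof -
  have "rho s \<in> cycle s" using rho_pow_in_cycle[of 1 s] by simp
  then have "ebwt_rows N (rho s) = ebwt_rows N s" by (rule ebwt_rows_cycle)
  moreover have "image_mset rho (ebwt_rows N s) = ebwt_rows N (rho s)"
    by (simp add: ebwt_rows_def multiset.map_comp comp_def rho_wpow funpow_swap1)
  ultimately show ?thesis by simp
qed

lemma all_rows_rho: "image_mset rho (all_rows N \<sigma>) = all_rows N \<sigma>"
  by (induction \<sigma>) (auto simp: ebwt_rows_rho)

text \<open>Equal rows are equal non-empty powers of primitive rotations, so the rotations agree; as
  rotations of a primitive word are distinct, no row is repeated.\<close>

lemma ebwt_rows_primitive: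
  assumes "primitive s" "length s dvd N" "N > 0"
  shows "ebwt_rows N s = mset_set ((\<lambda>u. wpow u (N div length s)) ` cycle s)"
proof -
  have pos: "N div length s > 0" using assms(2,3) by (auto simp: dvd_def)
  have inj: "inj_on (\<lambda>j. wpow ((rho ^^ j) s) (N div length s)) {..<length s}"
  proof (rule inj_onI)
    fix i j assume ij: "i \<in> {..<length s}" "j \<in> {..<length s}"
      "wpow ((rho ^^ i) s) (N div length s) = wpow ((rho ^^ j) s) (N div length s)"
    have "wpow ((rho ^^ i) s) (N div length s) \<noteq> []"
      using pos ij by (auto simp flip: length_greater_0_conv)
    then have "(rho ^^ i) s = (rho ^^ j) s"
      using primitive_root_unique primitive_rho_pow[OF assms(1)] ij(3) by blast
    then show "i = j"
      using primitive_rotations_distinct[OF assms(1)] ij by (auto dest: inj_onD)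
  qed
  show ?thesis
    using image_mset_mset_set[OF inj] by (simp add: ebwt_rows_def cycle_eq_image primitive_nonempty[OF assms(1)] image_image)
qed

lemma count_ebwt_rows:
  assumes "primitive s" "length s dvd N" "N > 0" "primitive t" "length t dvd N"
  shows "count (ebwt_rows N s) (wpow t (N div length t)) = (if cycle s = cycle t then 1 else 0)"
proof -
  have fin: "finite (cycle s)" using assms(1) by (simp add: finite_cycle primitive_nonempty)
  have "wpow t (N div length t) \<in> (\<lambda>u. wpow u (N div length s)) ` cycle s \<longleftrightarrow> cycle s = cycle t"
  proof
    assume "wpow t (N div length t) \<in> (\<lambda>u. wpow u (N div length s)) ` cycle s"
    then obtain j where eq: "wpow t (N div length t) = wpow ((rho ^^ j) s) (N div length s)"
      by (auto simp: cycle_def)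
    have "length (wpow t (N div length t)) = N" using assms by simp
    then have "wpow t (N div length t) \<noteq> []" using assms(3) by force
    then have "t = (rho ^^ j) s"
      using primitive_root_unique[OF _ _ eq] assms(4) primitive_rho_pow[OF assms(1)] by blast
    then have "t \<in> cycle s" by (simp add: rho_pow_in_cycle)
    then show "cycle s = cycle t" using cycle_of_mem by blast
  next
    assume "cycle s = cycle t"
    then have "t \<in> cycle s" using self_in_cycle by blast
    then show "wpow t (N div length t) \<in> (\<lambda>u. wpow u (N div length s)) ` cycle s"
      using length_cycle by fastforce
  qed
  then show ?thesis using fin by (simp add: ebwt_rows_primitive[OF assms(1-3)] count_mset_set')
qed

text \<open>Different cycles have no row in common, so the multiplicity of a cycle can be read off
  from any one of its rows.\<close>

lemma count_all_rows:
  assumes "\<sigma> \<in> mcyc A" "common_multiple \<sigma> N" "primitive t" "length t dvd N"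
  shows "count (all_rows N \<sigma>) (wpow t (N div length t)) = count \<sigma> (cycle t)"
  using assms(1,2)
proof (induction \<sigma>)
  case (add C \<sigma>)
  have "primitive (cyc_rep C)" "cycle (cyc_rep C) = C" using mcyc_cyc_rep[OF add.prems(1), of C] by auto
  then have "count (ebwt_rows N (cyc_rep C)) (wpow t (N div length t)) = (if C = cycle t then 1 else 0)"
    using add.prems assms by (simp add: count_ebwt_rows common_multiple_def)
  then show ?case using add by auto
qed simp

lemma all_rows_inject:
  assumes "\<sigma> \<in> mcyc A" "\<tau> \<in> mcyc A" "common_multiple \<sigma> N" "common_multiple \<tau> N"
    "all_rows N \<sigma> = all_rows N \<tau>"
  shows "\<sigma> = \<tau>"
proof (rule multiset_eqI)
  fix C
  have eq: "count \<sigma> C = count \<tau> C" if "C \<in># \<sigma> \<or> C \<in># \<tau>"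
  proof -
    have "primitive (cyc_rep C)" "cycle (cyc_rep C) = C" "length (cyc_rep C) dvd N"
      using that assms(3,4) mcyc_cyc_rep[OF assms(1)] mcyc_cyc_rep[OF assms(2)]
      unfolding common_multiple_def by blast+
    then show ?thesis using count_all_rows assms by metis
  qed
  show "count \<sigma> C = count \<tau> C"
    using eq by (cases "C \<in># \<sigma> \<or> C \<in># \<tau>") (auto simp: not_in_iff)
qed

text \<open>
  The rotations of the primitive root of any row form a sub-multiset that can be split off. In
  particular one never has to know that the words read off the cycles of the standard
  permutation in \<open>EBWT_surj\<close> are primitive.
\<close>

lemma all_rows_surj:
  assumes "image_mset rho R = R" "\<forall>x \<in># R. length x = N \<and> x \<in> lists A" "N > 0"
  shows "\<exists>\<sigma> \<in> mcyc A. common_multiple \<sigma> N \<and> all_rows N \<sigma> = R"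
  using assms
proof (induction "size R" arbitrary: R rule: less_induct)
  case less
  show ?case
  proof (cases "R = {#}")
    case True
    then show ?thesis using less.prems(3) by (intro bexI[of _ "{#}"]) (auto simp: common_multiple_def)
  next
    case False
    then obtain x where x: "x \<in># R" by auto
    then have len: "length x = N" and xA: "x \<in> lists A" using less.prems by auto
    then have "x \<noteq> []" using less.prems(3) by auto
    then obtain s d where s: "primitive s" "x = wpow s d" using exists_primitive_root by blast
    have sne: "s \<noteq> []" using s primitive_nonempty by auto
    have N: "N = d * length s" using len s by simp
    then have d: "d = N div length s" using sne by simp
    have dvd: "length s dvd N" using N by simp
    have "d > 0" using N less.prems(3) by (cases d) auto
    then have sA: "s \<in> lists A" using xA s by (cases d) auto
    have closed: "(rho ^^ j) x \<in># R" for j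
    proof (induction j)
      case (Suc j)
      then have "rho ((rho ^^ j) x) \<in># image_mset rho R" by (metis image_eqI set_image_mset)
      then show ?case using less.prems(1) by simp
    qed (use x in simp)
    \<comment> \<open>\<open>all_rows\<close> unfolds the cycle through \<open>cyc_rep\<close>,
      which may pick a rotation other than \<open>s\<close>; the rows are the same.\<close>
    define r where "r = cyc_rep (cycle s)"
    have r: "ebwt_rows N r = ebwt_rows N s" "length r = length s"
      using cyc_rep_in_cycle[of s] by (auto simp: r_def ebwt_rows_cycle length_cycle)
    \<comment> \<open>No row occurs twice in \<open>ebwt_rows N s\<close>, so it is enough that each
      of them is in \<open>R\<close>, and this follows from closure under
      \<open>rho\<close>.\<close>
    have sub: "ebwt_rows N s \<subseteq># R"
    proof (rule mset_subset_eqI)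
      fix u
      show "count (ebwt_rows N s) u \<le> count R u"
      proof (cases "u \<in> (\<lambda>u. wpow u (N div length s)) ` cycle s")
        case True
        then have "u \<in># R" using closed by (auto simp: cycle_def d[symmetric] s(2) rho_pow_wpow)
        then have "1 \<le> count R u" by simp
        moreover have "count (ebwt_rows N s) u \<le> 1"
          by (simp add: ebwt_rows_primitive[OF s(1) dvd less.prems(3)] count_mset_set')
        ultimately show ?thesis by linarith
      qed (simp add: ebwt_rows_primitive[OF s(1) dvd less.prems(3)])
    qed
    define R' where "R' = R - ebwt_rows N s"
    have R: "R = ebwt_rows N s + R'" using sub by (simp add: R'_def)
    have "image_mset rho R' = R'"
      using less.prems(1) by (simp add: R ebwt_rows_rho)
    moreover have "\<forall>x \<in># R'. length x = N \<and> x \<in> lists A"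
      using less.prems(2) by (auto simp: R'_def dest: in_diffD)
    moreover have "size R' < size R" using sne by (simp add: R ebwt_rows_def)
    ultimately obtain \<sigma> where "\<sigma> \<in> mcyc A" "common_multiple \<sigma> N" "all_rows N \<sigma> = R'"
      using less.hyps less.prems(3) by blast
    then show ?thesis
      using s sA dvd r R by (intro bexI[of _ "add_mset (cycle s) \<sigma>"]) (auto simp: r_def)
  qed
qed

subsection \<open>Bijectivity of the transform\<close>

lemma sorted_list_of_multiset_image:
  assumes "\<And>x y. x \<in># M \<Longrightarrow> y \<in># M \<Longrightarrow> x \<le> y \<Longrightarrow> f x \<le> f y"
  shows "sorted_list_of_multiset (image_mset f M) = map f (sorted_list_of_multiset M)"
proof -
  have "sorted (map f (sorted_list_of_multiset M))"
    unfolding sorted_map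
    by (rule sorted_wrt_mono_rel[OF _ sorted_sorted_list_of_multiset]) (use assms in auto)
  moreover have "image_mset f M = mset (map f (sorted_list_of_multiset M))" by simp
  ultimately show ?thesis by (metis sorted_list_of_multiset_mset sorted_sort_id)
qed

lemma take_mono_lex:
  fixes xs ys :: "'a::linorder list"
  shows "xs \<le> ys \<Longrightarrow> take j xs \<le> take j ys"
proof (induction j arbitrary: xs ys)
  case (Suc j)
  then show ?case by (cases xs; cases ys) auto
qed simp

lemma append_le_append_iff:
  fixes u v :: "'a::linorder list"
  assumes "length u = length v"
  shows "u @ x \<le> v @ y \<longleftrightarrow> u < v \<or> u = v \<and> x \<le> y"
  using assms by (induction u v rule: list_induct2) auto

lemma wpow_mono:
  fixes u v :: "'a::linorder list"
  assumes "length u = length v" "u \<le> v"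
  shows "wpow u d \<le> wpow v d"
  by (induction d) (use assms in \<open>auto simp: append_le_append_iff\<close>)

text \<open>Passing from the least common multiple to \<open>N\<close> replaces every row by its
  \<open>d\<close>-th power. For rows of equal length this preserves the order, and it keeps the
  last letter.\<close>

lemma EBWT_eq_all_rows:
  assumes "\<sigma> \<in> mcyc A" "common_multiple \<sigma> N"
  shows "EBWT \<sigma> = map last (sorted_list_of_multiset (all_rows N \<sigma>))"
proof -
  let ?c = "ebwt_lcm \<sigma>"
  have c: "common_multiple \<sigma> ?c" by (rule common_multiple_ebwt_lcm[OF assms(1)])
  have "?c dvd N" using assms(2) by (simp add: ebwt_lcm_dvd_iff common_multiple_def)
  then obtain d where N: "N = ?c * d" by (auto simp: dvd_def)
  have d: "d > 0" using N assms(2) by (cases d) (auto simp: common_multiple_def)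
  have "sorted_list_of_multiset (all_rows N \<sigma>)
      = map (\<lambda>u. wpow u d) (sorted_list_of_multiset (all_rows ?c \<sigma>))"
    unfolding N all_rows_mult[OF c]
    by (rule sorted_list_of_multiset_image) (auto intro!: wpow_mono simp: length_all_rows[OF c])
  then show ?thesis
    using d by (simp add: EBWT_def ebwt_table_def all_rows_def last_wpow)
qed

text \<open>
  The multiset of length-\<open>j\<close> prefixes of the table rows, recovered from the last column \<open>w\<close> alone:
  rotating every row by one place puts the last column in front and permutes the rows, and prefixes
  of sorted rows are sorted.
\<close>

primrec row_prefixes :: "'a::linorder list \<Rightarrow> nat \<Rightarrow> 'a list multiset" where
  "row_prefixes w 0 = replicate_mset (length w) []"
| "row_prefixes w (Suc j) = mset (map2 (#) w (sorted_list_of_multiset (row_prefixes w j)))"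

lemma take_rows_eq_row_prefixes:
  assumes "image_mset rho R = R" "\<forall>x \<in># R. length x = N" "j \<le> N"
  shows "image_mset (take j) R = row_prefixes (map last (sorted_list_of_multiset R)) j"
  using assms(3)
proof (induction j)
  case 0
  have "length (sorted_list_of_multiset R) = size R" by (metis mset_sorted_list_of_multiset size_mset)
  then show ?case by (simp add: image_mset_const_eq)
next
  case (Suc j)
  define L where "L = sorted_list_of_multiset R"
  have R: "R = mset L" by (simp add: L_def)
  have IH: "row_prefixes (map last L) j = image_mset (take j) R" using Suc by (simp add: L_def)
  have sorted: "sorted_list_of_multiset (image_mset (take j) R) = map (take j) L"
    unfolding L_def by (rule sorted_list_of_multiset_image) (rule take_mono_lex)
  have "image_mset (take (Suc j)) R = image_mset (take (Suc j)) (image_mset rho R)"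
    by (simp only: assms(1))
  also have "\<dots> = mset (map (\<lambda>x. take (Suc j) (rho x)) L)"
    by (simp add: R multiset.map_comp comp_def)
  also have "map (\<lambda>x. take (Suc j) (rho x)) L = map (\<lambda>x. last x # take j x) L"
    using assms(2) Suc.prems by (auto simp: R take_Suc_rho)
  also have "\<dots> = map2 (#) (map last L) (map (take j) L)"
    by (induction L) auto
  also have "mset \<dots> = row_prefixes (map last L) (Suc j)" by (simp add: IH sorted)
  finally show ?case by (simp add: L_def)
qed

lemma take_all_rows:
  assumes "\<sigma> \<in> mcyc A" "common_multiple \<sigma> N" "j \<le> N"
  shows "image_mset (take j) (all_rows N \<sigma>) = row_prefixes (EBWT \<sigma>) j"
  unfolding EBWT_eq_all_rows[OF assms(1,2)]
  by (rule take_rows_eq_row_prefixes[OF all_rows_rho _ assms(3)])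
    (use length_all_rows[OF assms(2)] in blast)

text \<open>At a row length common to both sequences, the prefixes of full length are the rows
  themselves. Equal transforms thus give equal rows, which determine the cycles.\<close>

lemma EBWT_inj: "inj_on EBWT (mcyc A)"
proof (rule inj_onI)
  fix \<sigma> \<tau> :: "'a list set multiset"
  assume *: "\<sigma> \<in> mcyc A" "\<tau> \<in> mcyc A" "EBWT \<sigma> = EBWT \<tau>"
  let ?N = "ebwt_lcm \<sigma> * ebwt_lcm \<tau>"
  have "common_multiple \<sigma> ?N" "common_multiple \<tau> (ebwt_lcm \<tau> * ebwt_lcm \<sigma>)"
    using * common_multiple_ebwt_lcm by (metis common_multiple_def common_multiple_mult)+
  then have cm: "common_multiple \<sigma> ?N" "common_multiple \<tau> ?N" by (simp_all add: mult.commute)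
  have "all_rows ?N x = image_mset (take ?N) (all_rows ?N x)" if "common_multiple x ?N"
    for x :: "'a list set multiset"
    using length_all_rows[OF that] by (simp add: multiset.map_ident_strong)
  then have "all_rows ?N \<sigma> = all_rows ?N \<tau>"
    using * cm take_all_rows by (metis order_refl)
  then show "\<sigma> = \<tau>" using all_rows_inject * cm by blast
qed

text \<open>\<open>\<pi> i\<close> is the position in \<open>w\<close> of the \<open>i\<close>-th
  letter of the sorted word, with equal letters kept in their original order: the standard
  permutation of \<open>w\<close>.\<close>

lemma stable_sorting_permutation:
  fixes w :: "'a::linorder list"
  obtains \<pi> where "\<pi> permutes {..<length w}"
    "\<And>i j. i < j \<Longrightarrow> j < length w \<Longrightarrow>
       w ! \<pi> i < w ! \<pi> j \<or> w ! \<pi> i = w ! \<pi> j \<and> \<pi> i < \<pi> j"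
proof -
  define n where "n = length w"
  \<comment> \<open>Pairing letters with positions makes the entries distinct, and the lexicographic
    order on pairs breaks ties by position.\<close>
  define S where "S = (\<lambda>i. (w ! i, i)) ` {..<n}"
  define L where "L = sorted_list_of_set S"
  have S: "finite S" "card S = n" "snd ` S = {..<n}" "inj_on snd S"
    by (auto simp: S_def card_image inj_on_def image_image)
  have L: "set L = S" "length L = n" "distinct L" "sorted_wrt (<) L"
    using S by (auto simp: L_def)
  have nth_S: "\<exists>i. L ! i0 = (w ! i, i)" if "i0 < n" for i0
  proof -
    have "L ! i0 \<in> S" using L that nth_mem by metis
    then show ?thesis by (auto simp: S_def)
  qed
  define \<pi> where "\<pi> = (\<lambda>i. if i < n then snd (L ! i) else i)"
  have "bij_betw ((!) (map snd L)) {..<n} {..<n}"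
    using S L by (intro bij_betw_nth) (auto simp: distinct_map)
  moreover have "bij_betw \<pi> {..<n} {..<n} = bij_betw ((!) (map snd L)) {..<n} {..<n}"
    by (rule bij_betw_cong) (auto simp: \<pi>_def L)
  ultimately have "\<pi> permutes {..<n}" by (intro bij_imp_permutes) (auto simp: \<pi>_def)
  moreover have "w ! \<pi> i < w ! \<pi> j \<or> w ! \<pi> i = w ! \<pi> j \<and> \<pi> i < \<pi> j"
    if "i < j" "j < n" for i j
  proof -
    have "L ! i < L ! j" using L that by (auto simp: sorted_wrt_iff_nth_less)
    then show ?thesis
      using that nth_S[of i] nth_S[of j] by (auto simp: \<pi>_def)
  qed
  ultimately show ?thesis using that unfolding n_def by blast
qed

lemma EBWT_surj:
  fixes w :: "'a::linorder list"
  assumes "w \<in> lists A"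
  shows "\<exists>\<sigma> \<in> mcyc A. EBWT \<sigma> = w"
proof -
  define n where "n = length w"
  obtain \<pi> where perm: "\<pi> permutes {..<n}" and stable: "\<And>i j. i < j \<Longrightarrow> j < n \<Longrightarrow>
       w ! \<pi> i < w ! \<pi> j \<or> w ! \<pi> i = w ! \<pi> j \<and> \<pi> i < \<pi> j"
    using stable_sorting_permutation[of w] unfolding n_def by blast
  \<comment> \<open>A permutation of a finite set has finite order; a positive exponent
    \<open>N\<close> with \<open>\<pi> ^^ N = id\<close> serves as the row length.\<close>
  have "permutation \<pi>" using perm by (auto simp: permutation_permutes)
  then obtain N where N: "\<pi> ^^ N = id" "N > 0" by (rule permutation_is_nilpotent)
  have less: "(\<pi> ^^ t) i < n" if "i < n" for t i
    by (induction t) (use that permutes_in_image[OF perm] in auto)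
  \<comment> \<open>\<open>X N i\<close> is going to be row \<open>i\<close>: its first letter is the \<open>i\<close>-th letter of the sorted word, and
     rotating it left by one place gives row \<open>\<pi> i\<close>.\<close>
  define X where "X = (\<lambda>j i. map (\<lambda>t. w ! ((\<pi> ^^ Suc t) i)) [0..<j])"
  have X_Suc: "X (Suc j) i = w ! \<pi> i # X j (\<pi> i)" for i j
    by (simp add: X_def map_upt_Suc funpow_swap1 del: upt_Suc)
  have X_Suc': "X (Suc j) i = X j i @ [w ! ((\<pi> ^^ Suc j) i)]" for i j
    by (simp add: X_def)
  \<comment> \<open>Stability drives the induction: if the first letters agree, then
    \<open>\<pi> i < \<pi> i'\<close>, so the tails are compared by the induction
    hypothesis.\<close>
  have X_mono: "X j i \<le> X j i'" if "i \<le> i'" "i' < n" for i i' j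
    using that
  proof (induction j arbitrary: i i')
    case (Suc j)
    show ?case
    proof (cases "i = i'")
      case False
      then have "w ! \<pi> i < w ! \<pi> i' \<or> w ! \<pi> i = w ! \<pi> i' \<and> \<pi> i < \<pi> i'"
        using stable Suc.prems by simp
      moreover have "\<pi> i' < n" using less[of i' 1] Suc.prems by simp
      ultimately show ?thesis using Suc.IH by (auto simp: X_Suc)
    qed simp
  qed (simp add: X_def)
  define L where "L = map (X N) [0..<n]"
  have "sorted L"
    unfolding L_def by (auto simp: sorted_iff_nth_mono intro: X_mono)
  then have sorted: "sorted_list_of_multiset (mset L) = L" by (simp add: sorted_sort_id)
  \<comment> \<open>The first letter of row \<open>i\<close>, moved to the end, is the last letter
    of row \<open>\<pi> i\<close> because following \<open>\<pi>\<close> for \<open>N\<close> steps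
    returns to the start.\<close>
  have rot: "rotate1 (X N i) = X N (\<pi> i)" for i
  proof -
    obtain N' where N': "N = Suc N'" using N(2) gr0_conv_Suc by blast
    have "rotate1 (X N i) = X N' (\<pi> i) @ [w ! \<pi> i]" by (simp add: N' X_Suc)
    also have "w ! \<pi> i = w ! ((\<pi> ^^ Suc N') (\<pi> i))" using N(1) by (simp only: N' id_apply)
    finally show ?thesis by (simp only: X_Suc' N')
  qed
  have L: "mset L = image_mset (X N) (mset_set {..<n})"
    by (simp add: L_def lessThan_atLeast0)
  have "image_mset \<pi> (mset_set {..<n}) = mset_set {..<n}"
    using image_mset_mset_set[of \<pi> "{..<n}"] permutes_inj_on[OF perm] permutes_image[OF perm] by metis
  then have "image_mset (X N) (image_mset \<pi> (mset_set {..<n})) = mset L" by (simp add: L)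
  then have "image_mset rotate1 (mset L) = mset L"
    by (simp add: L multiset.map_comp comp_def rot)
  then have "image_mset rho (mset L) = image_mset rho (image_mset rotate1 (mset L))" by simp
  also have "\<dots> = mset L" by (simp add: multiset.map_comp comp_def)
  finally have "image_mset rho (mset L) = mset L" .
  moreover have "\<forall>x \<in># mset L. length x = N \<and> x \<in> lists A"
  proof
    fix x assume "x \<in># mset L"
    then obtain i where i: "i < n" "x = X N i" by (auto simp: L_def)
    have "w ! ((\<pi> ^^ Suc t) i) \<in> A" for t
      using less[OF i(1), of "Suc t"] assms by (auto simp del: funpow.simps simp: n_def)
    then show "length x = N \<and> x \<in> lists A" by (auto simp: i X_def)
  qed
  ultimately obtain \<sigma> where \<sigma>: "\<sigma> \<in> mcyc A" "common_multiple \<sigma> N" "all_rows N \<sigma> = mset L"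
    using all_rows_surj N(2) by blast
  \<comment> \<open>The exponents in a row run from 1 to \<open>N\<close>, so its last letter is
    read at \<open>(\<pi> ^^ N) i = i\<close>.\<close>
  have "last (X N i) = w ! i" for i
  proof -
    obtain N' where N': "N = Suc N'" using N(2) gr0_conv_Suc by blast
    have "last (X N i) = w ! ((\<pi> ^^ N) i)" by (simp only: N' X_Suc' last_snoc)
    then show ?thesis using N(1) by simp
  qed
  then have "map last L = w" by (simp add: L_def n_def comp_def map_nth)
  then have "EBWT \<sigma> = w" using EBWT_eq_all_rows[OF \<sigma>(1,2)] by (simp only: \<sigma>(3) sorted)
  then show ?thesis using \<sigma>(1) by blast
qed

section \<open>Occurrence counts in terms of the transform\<close>

lemma occ_eq_count:
  assumes "length s dvd N" "length w \<le> N"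
  shows "occ w s = count (image_mset (take (length w)) (ebwt_rows N s)) w"
proof -
  have "(\<exists>p. prefix w (wpow ((rho ^^ j) s) p)) \<longleftrightarrow>
      take (length w) (wpow ((rho ^^ j) s) (N div length s)) = w" for j
    by (rule prefix_wpow_iff) (use assms in simp)
  then show ?thesis
    by (simp add: occ_size ebwt_rows_def count_conv_size_mset filter_mset_image_mset multiset.map_comp comp_def)
qed

lemma mc_occ_eq_count_rows:
  assumes "common_multiple \<sigma> N" "length w \<le> N"
  shows "mc_occ w \<sigma> = count (image_mset (take (length w)) (all_rows N \<sigma>)) w"
  using assms by (induction \<sigma>) (auto simp: mc_occ_def occ_eq_count)

lemma mc_occ_eq_count:
  assumes "\<sigma> \<in> mcyc A"
  shows "mc_occ w \<sigma> = count (row_prefixes (EBWT \<sigma>) (length w)) w"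
proof -
  \<comment> \<open>The factor makes the rows at least as long as \<open>w\<close>; the successor
    keeps it positive when \<open>w\<close> is empty.\<close>
  let ?N = "ebwt_lcm \<sigma> * Suc (length w)"
  have N: "common_multiple \<sigma> ?N" "ebwt_lcm \<sigma> > 0"
    using common_multiple_mult common_multiple_ebwt_lcm[OF assms] by (auto simp: common_multiple_def)
  then have "1 * length w \<le> ?N" by (intro mult_le_mono) auto
  then have "length w \<le> ?N" by simp
  then show ?thesis using mc_occ_eq_count_rows take_all_rows assms N by metis
qed

subsection \<open>Block structure of the transform of multicyclic de Bruijn sequences\<close>

definition words :: "nat \<Rightarrow> nat \<Rightarrow> nat list set" where
  "words q j = {u \<in> lists {..<q}. length u = j}"

lemma words_eq: "words q j = {u. set u \<subseteq> {..<q} \<and> length u = j}"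
  by (auto simp: words_def)

lemma finite_words [simp]: "finite (words q j)"
  by (simp add: words_eq finite_lists_length_eq)

lemma card_words: "card (words q j) = q ^ j"
  by (simp add: words_eq card_lists_length_eq)

lemma EBWT_in_lists:
  assumes "\<sigma> \<in> mcyc A" shows "EBWT \<sigma> \<in> lists A"
proof -
  let ?N = "ebwt_lcm \<sigma>"
  have c: "common_multiple \<sigma> ?N" by (rule common_multiple_ebwt_lcm[OF assms])
  have "last x \<in> A" if "x \<in># all_rows ?N \<sigma>" for x
  proof -
    have "x \<noteq> []" using length_all_rows[OF c that] c by (auto simp: common_multiple_def)
    then show ?thesis using all_rows_in_lists[OF assms that] by (metis in_listsD last_in_set)
  qed
  then show ?thesis by (auto simp: EBWT_eq_all_rows[OF assms c])
qed

lemma size_row_prefixes [simp]: "size (row_prefixes w j) = length w"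
proof (induction j)
  case (Suc j)
  have "length (sorted_list_of_multiset (row_prefixes w j)) = length w"
    using Suc by (metis mset_sorted_list_of_multiset size_mset)
  then show ?case by simp
qed simp

lemma row_prefixes_in_words:
  assumes "w \<in> lists {..<q}"
  shows "u \<in># row_prefixes w j \<Longrightarrow> u \<in> words q j"
proof (induction j arbitrary: u)
  case 0
  then show ?case by (simp add: words_def split: if_splits)
next
  case (Suc j)
  then obtain a v where "u = a # v" "(a, v) \<in> set (zip w (sorted_list_of_multiset (row_prefixes w j)))"
    by auto
  moreover from this have "a \<in> set w" "v \<in># row_prefixes w j"
    by (auto dest: set_zip_leftD set_zip_rightD)
  ultimately show ?case using Suc.IH[of v] assms by (auto simp: words_def)
qed

text \<open>Over the alphabet \<open>{..<q}\<close> no prefixes outside \<open>words q j\<close>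
  arise, so the counts on \<open>words q j\<close> determine the whole multiset.\<close>

lemma row_prefixes_uniform_iff:
  assumes "w \<in> lists {..<q}"
  shows "row_prefixes w j = repeat_mset M (mset_set (words q j)) \<longleftrightarrow>
    (\<forall>u \<in> words q j. count (row_prefixes w j) u = M)"
proof
  assume *: "\<forall>u \<in> words q j. count (row_prefixes w j) u = M"
  show "row_prefixes w j = repeat_mset M (mset_set (words q j))"
  proof (rule multiset_eqI)
    fix u
    show "count (row_prefixes w j) u = count (repeat_mset M (mset_set (words q j))) u"
      using * row_prefixes_in_words[OF assms, of u j]
      by (cases "u \<in> words q j") (auto simp: count_eq_zero_iff)
  qed
qed simp

lemma mset_concat_replicate: "mset (concat (map (replicate n) us)) = repeat_mset n (mset us)"
proof (induction us)
  case (Cons u us)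
  have "repeat_mset n {#u#} = replicate_mset n u" by (induction n) auto
  then show ?case using Cons by (metis add_mset_add_single concat.simps(2) list.simps(9)
      mset.simps(2) mset_append mset_replicate repeat_mset_distrib2 union_commute)
qed simp

lemma sorted_concat_replicate: "sorted us \<Longrightarrow> sorted (concat (map (replicate n) us))"
  by (induction us) (auto simp: sorted_append)

text \<open>Sorting puts the copies of each word next to each other; this is the source of the block
  structure.\<close>

lemma sorted_list_of_repeat_mset_set:
  "sorted_list_of_multiset (repeat_mset n (mset_set S)) = concat (map (replicate n) (sorted_list_of_set S))"
proof -
  have "repeat_mset n (mset_set S) = mset (concat (map (replicate n) (sorted_list_of_set S)))"
    by (simp only: mset_concat_replicate mset_sorted_list_of_multiset flip: sorted_list_of_mset_set)
  then show ?thesis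
    by (metis sorted_list_of_multiset_mset sorted_sort_id sorted_concat_replicate
        sorted_list_of_set.sorted_sorted_key_list_of_set)
qed

lemma split_blocks:
  "length w = n * L \<Longrightarrow> \<exists>ws. w = concat ws \<and> length ws = n \<and> (\<forall>v\<in>set ws. length v = L)"
proof (induction n arbitrary: w)
  case (Suc n)
  then have "length (drop L w) = n * L" by simp
  then obtain ws where "drop L w = concat ws" "length ws = n" "\<forall>v\<in>set ws. length v = L"
    using Suc.IH by blast
  then show ?case
    using Suc.prems by (intro exI[of _ "take L w # ws"]) (auto simp flip: \<open>drop L w = concat ws\<close>)
qed simp

lemma concat_blocks_inject:
  assumes "concat ws = concat vs" "length ws = length vs"
    "\<forall>v\<in>set ws. length v = L" "\<forall>v\<in>set vs. length v = L"
  shows "ws = vs"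
proof -
  have "\<forall>(x, y)\<in>set (zip ws vs). length x = length y"
    using assms(3,4) by (fastforce dest: set_zip_leftD set_zip_rightD)
  then show ?thesis using concat_injective assms(1,2) by blast
qed

text \<open>Each block of letters is aligned with the copies of a single word, so prepending can be
  done block by block.\<close>

lemma map2_Cons_blocks:
  assumes "length ws = length us" "\<forall>v\<in>set ws. length v = L"
  shows "map2 (#) (concat ws) (concat (map (replicate L) us))
       = concat (map2 (\<lambda>v u. map (\<lambda>a. a # u) v) ws us)"
  using assms by (induction ws us rule: list_induct2) (auto simp: zip_replicate2 comp_def)

lemma count_map_Cons: "count (mset (map (\<lambda>b. b # u) v)) (a # u') = (if u = u' then count_list v a else 0)"
  by (induction v) auto

lemma count_blocks_notin:
  "length ws = length us \<Longrightarrow> u \<notin> set us \<Longrightarrow>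
    count (mset (concat (map2 (\<lambda>v u. map (\<lambda>a. a # u) v) ws us))) (a # u) = 0"
  by (induction ws us rule: list_induct2) (auto simp: count_map_Cons simp del: mset_map)

text \<open>Since \<open>us\<close> is distinct, only the \<open>i\<close>-th block can produce
  words with tail \<open>us ! i\<close>.\<close>

lemma count_blocks:
  "length ws = length us \<Longrightarrow> distinct us \<Longrightarrow> i < length us \<Longrightarrow>
    count (mset (concat (map2 (\<lambda>v u. map (\<lambda>a. a # u) v) ws us))) (a # us ! i) = count_list (ws ! i) a"
proof (induction ws us arbitrary: i rule: list_induct2)
  case (Cons v ws u us)
  show ?case
  proof (cases i)
    case 0
    have "count (mset (concat (map2 (\<lambda>v u. map (\<lambda>a. a # u) v) ws us))) (a # u) = 0"
      by (rule count_blocks_notin) (use Cons in auto)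
    then show ?thesis using 0 by (simp add: count_map_Cons del: mset_map)
  next
    case (Suc i')
    then have "us ! i' \<noteq> u" using Cons.prems by auto
    then show ?thesis using Suc Cons by (simp add: count_map_Cons del: mset_map)
  qed
qed simp

text \<open>The induction step on prefix length. Uniformity at \<open>j\<close> aligns each
  \<open>j\<close>-mer with one block of \<open>M * q\<close> letters of \<open>w\<close>, and the
  number of \<open>a\<close> in that block is the count of the \<open>j\<close>-mer extended by
  \<open>a\<close> in front.\<close>

lemma row_prefixes_uniform_Suc_iff:
  assumes w: "w \<in> lists {..<q}" and unif: "row_prefixes w j = repeat_mset (M * q) (mset_set (words q j))"
  shows "row_prefixes w (Suc j) = repeat_mset M (mset_set (words q (Suc j))) \<longleftrightarrow>
    w \<in> lang_pow (Pwords M q) (q ^ j)"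
proof -
  define us where "us = sorted_list_of_set (words q j)"
  have us: "distinct us" "length us = q ^ j" "set us = words q j"
    by (auto simp: us_def card_words)
  have "length w = q ^ j * (M * q)"
    using arg_cong[OF unif, of size] by (simp add: card_words)
  then obtain ws where ws: "w = concat ws" "length ws = q ^ j" "\<forall>v\<in>set ws. length v = M * q"
    using split_blocks by blast
  have rows: "row_prefixes w (Suc j) = mset (concat (map2 (\<lambda>v u. map (\<lambda>a. a # u) v) ws us))"
    unfolding row_prefixes.simps unif sorted_list_of_repeat_mset_set us_def[symmetric]
    unfolding ws(1) by (subst map2_Cons_blocks) (use ws us in auto)
  have words_Suc: "words q (Suc j) = {a # us ! i | a i. a < q \<and> i < q ^ j}"
  proof -
    have "words q (Suc j) = {a # u | a u. a < q \<and> u \<in> words q j}"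
      by (auto simp: words_def length_Suc_conv)
    also have "\<dots> = {a # us ! i | a i. a < q \<and> i < q ^ j}"
      unfolding us(3)[symmetric] in_set_conv_nth us(2) by blast
    finally show ?thesis .
  qed
  have cnt: "count (row_prefixes w (Suc j)) (a # us ! i) = count_list (ws ! i) a" if "i < q ^ j" for a i
    unfolding rows by (rule count_blocks) (use us ws that in auto)
  have wsP: "ws ! i \<in> Pwords M q \<longleftrightarrow> (\<forall>a<q. count_list (ws ! i) a = M)" if "i < q ^ j" for i
  proof -
    have "ws ! i \<in> set ws" using that ws by simp
    then show ?thesis using ws w by (auto simp: Pwords_def)
  qed
  have "row_prefixes w (Suc j) = repeat_mset M (mset_set (words q (Suc j))) \<longleftrightarrow>
      (\<forall>u \<in> words q (Suc j). count (row_prefixes w (Suc j)) u = M)"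
    by (rule row_prefixes_uniform_iff[OF w])
  also have "\<dots> \<longleftrightarrow> (\<forall>i < q ^ j. \<forall>a<q. count (row_prefixes w (Suc j)) (a # us ! i) = M)"
    unfolding words_Suc by blast
  also have "\<dots> \<longleftrightarrow> (\<forall>i < q ^ j. ws ! i \<in> Pwords M q)"
    using cnt wsP by simp
  also have "\<dots> \<longleftrightarrow> set ws \<subseteq> Pwords M q"
    using ws(2) by (auto simp: in_set_conv_nth subset_iff)
  also have "\<dots> \<longleftrightarrow> w \<in> lang_pow (Pwords M q) (q ^ j)"
  proof
    assume "w \<in> lang_pow (Pwords M q) (q ^ j)"
    then obtain vs where vs: "w = concat vs" "length vs = q ^ j" "set vs \<subseteq> Pwords M q"
      by (auto simp: lang_pow_def)
    then have "\<forall>v\<in>set vs. length v = M * q" by (auto simp: Pwords_def)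
    \<comment> \<open>Blocks of fixed length are unique, so any factorisation of \<open>w\<close>
      into words of \<open>Pwords M q\<close> is the one already chosen.\<close>
    then have "ws = vs" using concat_blocks_inject ws vs by metis
    then show "set ws \<subseteq> Pwords M q" using vs by simp
  qed (use ws in \<open>auto simp: lang_pow_def\<close>)
  finally show ?thesis .
qed

text \<open>Each \<open>j\<close>-mer has exactly \<open>q\<close> extensions by a letter on the
  right.\<close>

lemma take_uniform_words:
  "image_mset (take j) (repeat_mset m (mset_set (words q (Suc j)))) = repeat_mset (m * q) (mset_set (words q j))"
proof -
  have "image_mset (take j) (mset_set (words q (Suc j))) = repeat_mset q (mset_set (words q j))"
  proof (rule multiset_eqI)
    fix u
    have c: "count (image_mset (take j) (mset_set (words q (Suc j)))) u
        = card {x \<in> words q (Suc j). take j x = u}"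
      by (simp add: count_image_mset_eq_card_vimage)
    show "count (image_mset (take j) (mset_set (words q (Suc j)))) u
        = count (repeat_mset q (mset_set (words q j))) u"
    proof (cases "u \<in> words q j")
      case True
      have "{x \<in> words q (Suc j). take j x = u} = (\<lambda>a. u @ [a]) ` {..<q}"
      proof (intro subset_antisym subsetI)
        fix x assume x: "x \<in> {x \<in> words q (Suc j). take j x = u}"
        then obtain y a where "x = y @ [a]" by (cases x rule: rev_cases) (auto simp: words_def)
        then show "x \<in> (\<lambda>a. u @ [a]) ` {..<q}" using x by (auto simp: words_def)
      qed (use True in \<open>auto simp: words_def\<close>)
      then show ?thesis using True c by (simp add: card_image inj_on_def)
    next
      case False
      have "{x \<in> words q (Suc j). take j x = u} = {}"
        using False by (auto simp: words_def dest: in_set_takeD)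
      then show ?thesis using False c by simp
    qed
  qed
  moreover have "image_mset (take j) (repeat_mset m X) = repeat_mset m (image_mset (take j) X)"
    for X :: "nat list multiset"
    by (induction m) auto
  ultimately show ?thesis by simp
qed

lemma concat_map_concat: "concat (map concat xss) = concat (concat xss)"
  by (induction xss) auto

text \<open>Regroups consecutive factors into coarser blocks, as needed for prefixes shorter than
  the final length.\<close>

lemma lang_pow_mult: "lang_pow A (a * b) \<subseteq> lang_pow (lang_pow A a) b"
proof
  fix w assume "w \<in> lang_pow A (a * b)"
  then obtain ws where ws: "w = concat ws" "length ws = b * a" "set ws \<subseteq> A"
    by (auto simp: lang_pow_def mult.commute)
  then obtain wss where wss: "ws = concat wss" "length wss = b" "\<forall>v\<in>set wss. length v = a"
    using split_blocks by blast
  have "w = concat (map concat wss)" using ws wss by (simp add: concat_map_concat)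
  moreover have "concat v \<in> lang_pow A a" if "v \<in> set wss" for v
    using that wss ws unfolding lang_pow_def by auto
  then have "set (map concat wss) \<subseteq> lang_pow A a" by auto
  moreover have "length (map concat wss) = b" using wss(2) by simp
  ultimately show "w \<in> lang_pow (lang_pow A a) b"
    unfolding lang_pow_def[of "lang_pow A a"] by blast
qed

lemma lang_pow_Pwords: "lang_pow (Pwords m q) a \<subseteq> Pwords (m * a) q"
proof -
  have "set ws \<subseteq> Pwords m q \<Longrightarrow> concat ws \<in> Pwords (m * length ws) q" for ws
    by (induction ws) (auto simp: Pwords_def algebra_simps)
  then show ?thesis by (auto simp: lang_pow_def)
qed

lemma lang_pow_mono: "A \<subseteq> B \<Longrightarrow> lang_pow A n \<subseteq> lang_pow B n"
  by (auto simp: lang_pow_def)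

text \<open>A balanced block structure at level \<open>j\<close> yields one at every coarser level,
  so uniformity can be built up from the empty prefix one letter at a time.\<close>

lemma lang_pow_Pwords_uniform:
  assumes "w \<in> lang_pow (Pwords m q) (q ^ j)"
  shows "row_prefixes w (Suc j) = repeat_mset m (mset_set (words q (Suc j)))"
proof -
  have wP: "w \<in> Pwords (m * q ^ j) q" using assms lang_pow_Pwords by blast
  then have w: "w \<in> lists {..<q}" by (simp add: Pwords_def)
  \<comment> \<open>The total length \<open>m * q ^ Suc j\<close> is shared equally among the
    \<open>q ^ i\<close> words of length \<open>i\<close>.\<close>
  have "i \<le> Suc j \<Longrightarrow> row_prefixes w i = repeat_mset (m * q ^ (Suc j - i)) (mset_set (words q i))" for i
  proof (induction i)
    case 0
    have "words q 0 = {[]}" by (auto simp: words_def)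
    moreover have "repeat_mset n {#[]#} = replicate_mset n []" for n by (induction n) auto
    ultimately show ?case using wP by (simp add: Pwords_def algebra_simps)
  next
    case (Suc i)
    \<comment> \<open>Merging \<open>q ^ (j - i)\<close> neighbouring blocks at a time gives
      \<open>q ^ i\<close> blocks, each still balanced.\<close>
    have "w \<in> lang_pow (lang_pow (Pwords m q) (q ^ (j - i))) (q ^ i)"
      using assms lang_pow_mult[of "Pwords m q" "q ^ (j - i)" "q ^ i"] Suc.prems
      by (auto simp flip: power_add)
    then have "w \<in> lang_pow (Pwords (m * q ^ (j - i)) q) (q ^ i)"
      using lang_pow_mono[OF lang_pow_Pwords] by blast
    moreover have "row_prefixes w i = repeat_mset (m * q ^ (j - i) * q) (mset_set (words q i))"
      using Suc by (simp add: Suc_diff_le mult_ac)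
    ultimately have "row_prefixes w (Suc i) = repeat_mset (m * q ^ (j - i)) (mset_set (words q (Suc i)))"
      using row_prefixes_uniform_Suc_iff[OF w] by blast
    then show ?case by (simp only: diff_Suc_Suc)
  qed
  from this[of "Suc j"] show ?thesis by simp
qed

text \<open>Uniform counts at length \<open>Suc j\<close> are inherited by length \<open>j\<close>
  through truncation of the rows, so the one-step equivalence applies. The converse needs the whole
  induction on prefix length.\<close>

lemma MCDB_eq_EBWT:
  "MCDB m q (Suc j) = {\<sigma> \<in> mcyc {..<q}. EBWT \<sigma> \<in> lang_pow (Pwords m q) (q ^ j)}"
proof -
  have "\<sigma> \<in> MCDB m q (Suc j) \<longleftrightarrow> EBWT \<sigma> \<in> lang_pow (Pwords m q) (q ^ j)" if \<sigma>: "\<sigma> \<in> mcyc {..<q}" for \<sigma>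
  proof -
    have w: "EBWT \<sigma> \<in> lists {..<q}" using EBWT_in_lists[OF \<sigma>] .
    have "\<sigma> \<in> MCDB m q (Suc j) \<longleftrightarrow> (\<forall>u \<in> words q (Suc j). count (row_prefixes (EBWT \<sigma>) (Suc j)) u = m)"
      using \<sigma> unfolding MCDB_def multicyclic_def mcyc_def words_def
      by (auto simp: mc_occ_eq_count[OF \<sigma>] simp del: row_prefixes.simps)
    also have "\<dots> \<longleftrightarrow> row_prefixes (EBWT \<sigma>) (Suc j) = repeat_mset m (mset_set (words q (Suc j)))"
      by (rule row_prefixes_uniform_iff[OF w, symmetric])
    also have "\<dots> \<longleftrightarrow> EBWT \<sigma> \<in> lang_pow (Pwords m q) (q ^ j)"
    proof
      assume u: "row_prefixes (EBWT \<sigma>) (Suc j) = repeat_mset m (mset_set (words q (Suc j)))"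
      let ?N = "ebwt_lcm \<sigma> * Suc j"
      have N: "common_multiple \<sigma> ?N" "ebwt_lcm \<sigma> > 0"
        using common_multiple_mult common_multiple_ebwt_lcm[OF \<sigma>] by (auto simp: common_multiple_def)
      then have "1 * Suc j \<le> ?N" by (intro mult_le_mono) auto
      then have le: "Suc j \<le> ?N" by simp
      have "row_prefixes (EBWT \<sigma>) j = image_mset (take j) (all_rows ?N \<sigma>)"
        using take_all_rows[OF \<sigma> N(1)] le by simp
      also have "\<dots> = image_mset (take j) (image_mset (take (Suc j)) (all_rows ?N \<sigma>))"
        by (simp add: multiset.map_comp comp_def min_def)
      also have "\<dots> = repeat_mset (m * q) (mset_set (words q j))"
        by (simp only: take_all_rows[OF \<sigma> N(1) le] u take_uniform_words)
      finally show "EBWT \<sigma> \<in> lang_pow (Pwords m q) (q ^ j)" using row_prefixes_uniform_Suc_iff[OF w] u by blast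
    qed (rule lang_pow_Pwords_uniform)
    finally show ?thesis .
  qed
  moreover have "MCDB m q (Suc j) \<subseteq> mcyc {..<q}" by (auto simp: MCDB_def multicyclic_def mcyc_def)
  ultimately show ?thesis by blast
qed

section \<open>Cardinalities and the final count\<close>

lemma card_lang_pow:
  assumes "finite A" "\<forall>v\<in>A. length v = L"
  shows "card (lang_pow A n) = card A ^ n"
proof -
  have "lang_pow A n = concat ` {ws. set ws \<subseteq> A \<and> length ws = n}"
    by (auto simp: lang_pow_def)
  \<comment> \<open>Factors of one fixed length can be recovered from their concatenation.\<close>
  moreover have "inj_on concat {ws. set ws \<subseteq> A \<and> length ws = n}"
  proof (rule inj_onI)
    fix ws vs assume "ws \<in> {ws. set ws \<subseteq> A \<and> length ws = n}" "vs \<in> {ws. set ws \<subseteq> A \<and> length ws = n}"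
      "concat ws = concat vs"
    then show "ws = vs" using assms(2) by (intro concat_blocks_inject[of _ _ L]) auto
  qed
  ultimately show ?thesis using assms(1) by (simp add: card_image card_lists_length_eq)
qed

text \<open>Viewing these words as the arrangements of a multiset makes the multinomial formula
  available.\<close>

lemma Pwords_eq_permutations:
  "Pwords m q = permutations_of_multiset (repeat_mset m (mset_set {..<q}))"
proof (intro subset_antisym subsetI)
  fix w assume w: "w \<in> Pwords m q"
  have "count (mset w) a = count (repeat_mset m (mset_set {..<q})) a" for a
  proof (cases "a < q")
    case False
    then have "a \<notin> set w" using w by (auto simp: Pwords_def)
    then show ?thesis using False by (simp add: count_mset)
  qed (use w in \<open>auto simp: Pwords_def count_mset\<close>)
  then show "w \<in> permutations_of_multiset (repeat_mset m (mset_set {..<q}))"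
    by (intro permutations_of_multisetI multiset_eqI)
next
  fix w assume "w \<in> permutations_of_multiset (repeat_mset m (mset_set {..<q}))"
  then have w: "mset w = repeat_mset m (mset_set {..<q})" by (rule permutations_of_multisetD)
  have "set w \<subseteq> {..<q}"
  proof
    fix a assume "a \<in> set w"
    then have "a \<in># repeat_mset m (mset_set {..<q})" using w by (metis set_mset_mset)
    then have "count (repeat_mset m (mset_set {..<q})) a \<noteq> 0" by (simp only: count_eq_zero_iff) simp
    then show "a \<in> {..<q}" by (simp split: if_splits)
  qed
  moreover have "length w = m * q" using arg_cong[OF w, of size] by simp
  moreover have "count_list w a = m" if "a < q" for a
    using arg_cong[OF w, of "\<lambda>M. count M a"] that by (simp add: count_mset)
  ultimately show "w \<in> Pwords m q" by (auto simp: Pwords_def)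
qed

lemma card_Pwords:
  "real (card (Pwords m q)) = fact (m * q) / fact m ^ q"
\<comment> \<open>For \<open>m = 0\<close> the multiset is empty and its support need not be
  \<open>{..<q}\<close>, so this case is computed directly.\<close>
proof (cases "m = 0")
  case True
  then have "Pwords m q = {[]}" by (auto simp: Pwords_def)
  then show ?thesis using True by simp
next
  case False
  let ?M = "repeat_mset m (mset_set {..<q})"
  have set: "set_mset ?M = {..<q}" using False by (auto simp: set_eq_iff count_mset_set' split: if_splits simp flip: count_greater_zero_iff)
  have prod: "(\<Prod>x\<in>set_mset ?M. fact (count ?M x)) = (fact m ^ q :: nat)"
    unfolding set by simp
  \<comment> \<open>Divisibility turns the truncating division on naturals into a real
    quotient.\<close>
  then have "(fact m ^ q :: nat) dvd fact (m * q)"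
    using card_permutations_of_multiset(2)[of ?M] by simp
  moreover have "card (Pwords m q) = fact (m * q) div fact m ^ q"
    unfolding Pwords_eq_permutations card_permutations_of_multiset(1) prod by simp
  ultimately show ?thesis by (simp add: real_of_nat_div)
qed

theorem theorem5:
  fixes m q k :: nat
  assumes "m \<ge> 1" and "q \<ge> 1" and "k \<ge> 1"
  shows "EBWT ` MCDB m q k = lang_pow (Pwords m q) (q ^ (k - 1))
    \<and> real (card (MCDB m q k)) = W m q k
    \<and> W m q k = fact (m * q) ^ (q ^ (k - 1)) / fact m ^ (q ^ k)"
proof -
  obtain j where k: "k = Suc j" using assms(3) by (cases k) auto
  let ?P = "lang_pow (Pwords m q) (q ^ j)"
  have "w \<in> EBWT ` mcyc {..<q}" if "w \<in> ?P" for w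
  proof -
    have "w \<in> Pwords (m * q ^ j) q" using that lang_pow_Pwords by blast
    then have "w \<in> lists {..<q}" by (simp add: Pwords_def)
    then show ?thesis using EBWT_surj by blast
  qed
  then have image: "EBWT ` MCDB m q k = ?P" unfolding k MCDB_eq_EBWT by blast
  have "inj_on EBWT (MCDB m q k)"
    unfolding k MCDB_eq_EBWT by (rule inj_on_subset[OF EBWT_inj[of "{..<q}"]]) auto
  then have "card (MCDB m q k) = card ?P" by (simp flip: image add: card_image)
  also have "\<dots> = card (Pwords m q) ^ (q ^ j)"
  proof (rule card_lang_pow)
    show "finite (Pwords m q)" by (simp add: Pwords_eq_permutations)
    show "\<forall>v\<in>Pwords m q. length v = m * q" by (simp add: Pwords_def)
  qed
  finally have card: "real (card (MCDB m q k)) = W m q k"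
    by (simp add: k W_def card_Pwords)
  \<comment> \<open>The denominator \<open>(fact m ^ q) ^ (q ^ j)\<close> has total exponent
    \<open>q * q ^ j\<close>, which is \<open>q ^ k\<close>.\<close>
  have "W m q k = fact (m * q) ^ (q ^ j) / fact m ^ (q ^ k)"
    by (simp add: W_def k power_divide flip: power_mult)
  then show ?thesis using image card by (simp add: k)
qed

end
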